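(* Let $(\mathcal{C}, \otimes, \mathbb{1})$ be a strict monoidal bicategory and let $A, B, B' \in \mathcal{C}$. Assume there are biexact pairings $A \dashv B$ and $A \dashv B'$ witnessed by $(\varepsilon_1, \eta_1)$ and $(\varepsilon_1', \eta_1')$ respectively. Then there exist $1$-morphisms $\alpha: B \to B'$ and $\beta: B' \to B$ together with invertible $2$-morphisms $\beta \circ \alpha \cong \mathrm{id}_B$ and $\alpha \circ \beta \cong \mathrm{id}_{B'}$. The $1$-morphism $\alpha$ preserves evaluation and coevaluation, in the sense that there exist invertible $2$-morphisms $$\varepsilon_1' \circ (\mathrm{id}_A \otimes \alpha) \cong \varepsilon_1 \quad\text{and}\quad (\alpha \otimes \mathrm{id}_A) \circ \eta_1 \cong \eta_1'.$$ Furthermore, $\alpha$ is unique in the sense that for every other $1$-morphism $\tilde\alpha: B \to B'$ preserving evaluation and coevaluation in this way, there exists an invertible $2$-morphism $\alpha \cong \tilde\alpha$.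
   Context: A strict monoidal bicategory is a monoidal bicategory in which associativity and unitality of $\otimes$ on objects and $1$-morphisms may be suppressed; the interchange $(\mathrm{id} \otimes g) \circ (f \otimes \mathrm{id}) \cong (f \otimes \mathrm{id}) \circ (\mathrm{id} \otimes g)$ is given by invertible $2$-morphisms. A biexact pairing $x \dashv y$ between objects $x, y \in \mathcal{C}$ consists of a $1$-morphism $\varepsilon_1: x \otimes y \to \mathbb{1}$ (evaluation), a $1$-morphism $\eta_1: \mathbb{1} \to y \otimes x$ (coevaluation), and invertible $2$-morphisms $(\mathrm{id}_y \otimes \varepsilon_1) \circ (\eta_1 \otimes \mathrm{id}_y) \cong \mathrm{id}_y$ and $\mathrm{id}_x \cong (\varepsilon_1 \otimes \mathrm{id}_x) \circ (\mathrm{id}_x \otimes \eta_1)$. No further coherence conditions are imposed on these $2$-morphisms. *)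

theory Defs
  imports Main
begin

section \<open>Bicategories\<close>

text \<open>
  Composition of 1-morphisms is written in the usual order: \<open>g \<circ>\<^sub>1 f\<close> is \<open>g\<close> after \<open>f\<close>;
  \<open>\<cdot>\<close> is vertical and \<open>\<circ>\<^sub>2\<close> horizontal composition of 2-morphisms.  All operations are
  total functions whose values are only meaningful on composable arguments.
\<close>

record ('o, 'm, 't) bicat =
  Obj :: "'o set"
  Mor1 :: "'m set"
  Mor2 :: "'t set"
  src1 :: "'m \<Rightarrow> 'o"
  trg1 :: "'m \<Rightarrow> 'o"
  src2 :: "'t \<Rightarrow> 'm"
  trg2 :: "'t \<Rightarrow> 'm"
  id1 :: "'o \<Rightarrow> 'm"  ("id\<^sub>1\<index>")
  id2 :: "'m \<Rightarrow> 't"  ("id\<^sub>2\<index>")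
  comp1 :: "'m \<Rightarrow> 'm \<Rightarrow> 'm"  (infixr "\<circ>\<^sub>1\<index>" 70)
  vcomp :: "'t \<Rightarrow> 't \<Rightarrow> 't"  (infixr "\<cdot>\<index>" 65)
  hcomp :: "'t \<Rightarrow> 't \<Rightarrow> 't"  (infixr "\<circ>\<^sub>2\<index>" 70)
  assoc :: "'m \<Rightarrow> 'm \<Rightarrow> 'm \<Rightarrow> 't"
  lunit :: "'m \<Rightarrow> 't"
  runit :: "'m \<Rightarrow> 't"

definition hom1 :: "('o, 'm, 't, 'z) bicat_scheme \<Rightarrow> 'o \<Rightarrow> 'o \<Rightarrow> 'm set"
  where "hom1 C a b = {f \<in> Mor1 C. src1 C f = a \<and> trg1 C f = b}"

definition hom2 :: "('o, 'm, 't, 'z) bicat_scheme \<Rightarrow> 'm \<Rightarrow> 'm \<Rightarrow> 't set"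
  where "hom2 C f g = {\<theta> \<in> Mor2 C. src2 C \<theta> = f \<and> trg2 C \<theta> = g}"

definition invertible2 :: "('o, 'm, 't, 'z) bicat_scheme \<Rightarrow> 'm \<Rightarrow> 'm \<Rightarrow> 't \<Rightarrow> bool"
  where "invertible2 C f g \<theta> \<longleftrightarrow> \<theta> \<in> hom2 C f g \<and>
    (\<exists>\<theta>' \<in> hom2 C g f. \<theta>' \<cdot>\<^bsub>C\<^esub> \<theta> = id\<^sub>2\<^bsub>C\<^esub> f \<and> \<theta> \<cdot>\<^bsub>C\<^esub> \<theta>' = id\<^sub>2\<^bsub>C\<^esub> g)"

definition isomorphic1 :: "('o, 'm, 't, 'z) bicat_scheme \<Rightarrow> 'm \<Rightarrow> 'm \<Rightarrow> bool"
    (infix "\<cong>\<index>" 50)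
  where "f \<cong>\<^bsub>C\<^esub> g \<longleftrightarrow> (\<exists>\<theta>. invertible2 C f g \<theta>)"

locale bicategory =
  fixes C :: "('o, 'm, 't, 'z) bicat_scheme" (structure)
  assumes src1_Obj: "f \<in> Mor1 C \<Longrightarrow> src1 C f \<in> Obj C"
    and trg1_Obj: "f \<in> Mor1 C \<Longrightarrow> trg1 C f \<in> Obj C"
    and src2_Mor1: "\<theta> \<in> Mor2 C \<Longrightarrow> src2 C \<theta> \<in> Mor1 C"
    and trg2_Mor1: "\<theta> \<in> Mor2 C \<Longrightarrow> trg2 C \<theta> \<in> Mor1 C"
    and src_parallel: "\<theta> \<in> Mor2 C \<Longrightarrow> src1 C (src2 C \<theta>) = src1 C (trg2 C \<theta>)"
    and trg_parallel: "\<theta> \<in> Mor2 C \<Longrightarrow> trg1 C (src2 C \<theta>) = trg1 C (trg2 C \<theta>)"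
    and id1_hom: "a \<in> Obj C \<Longrightarrow> id\<^sub>1 a \<in> hom1 C a a"
    and comp1_hom: "\<lbrakk> g \<in> hom1 C b c; f \<in> hom1 C a b \<rbrakk> \<Longrightarrow> g \<circ>\<^sub>1 f \<in> hom1 C a c"
    \<comment> \<open>the hom-categories\<close>
    and id2_hom: "f \<in> Mor1 C \<Longrightarrow> id\<^sub>2 f \<in> hom2 C f f"
    and vcomp_hom: "\<lbrakk> \<kappa> \<in> hom2 C g h; \<theta> \<in> hom2 C f g \<rbrakk> \<Longrightarrow> \<kappa> \<cdot> \<theta> \<in> hom2 C f h"
    and vcomp_assoc:
      "\<lbrakk> \<zeta> \<in> hom2 C h k; \<kappa> \<in> hom2 C g h; \<theta> \<in> hom2 C f g \<rbrakk>
       \<Longrightarrow> (\<zeta> \<cdot> \<kappa>) \<cdot> \<theta> = \<zeta> \<cdot> (\<kappa> \<cdot> \<theta>)"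
    and vcomp_id_left: "\<theta> \<in> hom2 C f g \<Longrightarrow> id\<^sub>2 g \<cdot> \<theta> = \<theta>"
    and vcomp_id_right: "\<theta> \<in> hom2 C f g \<Longrightarrow> \<theta> \<cdot> id\<^sub>2 f = \<theta>"
    \<comment> \<open>functoriality of horizontal composition\<close>
    and hcomp_hom:
      "\<lbrakk> g \<in> hom1 C b c; f \<in> hom1 C a b; \<kappa> \<in> hom2 C g g'; \<theta> \<in> hom2 C f f' \<rbrakk>
       \<Longrightarrow> \<kappa> \<circ>\<^sub>2 \<theta> \<in> hom2 C (g \<circ>\<^sub>1 f) (g' \<circ>\<^sub>1 f')"
    and hcomp_id:
      "\<lbrakk> g \<in> hom1 C b c; f \<in> hom1 C a b \<rbrakk> \<Longrightarrow> id\<^sub>2 g \<circ>\<^sub>2 id\<^sub>2 f = id\<^sub>2 (g \<circ>\<^sub>1 f)"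
    and hcomp_vcomp:
      "\<lbrakk> g \<in> hom1 C b c; f \<in> hom1 C a b;
         \<kappa> \<in> hom2 C g g'; \<kappa>' \<in> hom2 C g' g''; \<theta> \<in> hom2 C f f'; \<theta>' \<in> hom2 C f' f'' \<rbrakk>
       \<Longrightarrow> (\<kappa>' \<cdot> \<kappa>) \<circ>\<^sub>2 (\<theta>' \<cdot> \<theta>) = (\<kappa>' \<circ>\<^sub>2 \<theta>') \<cdot> (\<kappa> \<circ>\<^sub>2 \<theta>)"
    \<comment> \<open>associator and unitors\<close>
    and assoc_invertible:
      "\<lbrakk> h \<in> hom1 C c d; g \<in> hom1 C b c; f \<in> hom1 C a b \<rbrakk>
       \<Longrightarrow> invertible2 C ((h \<circ>\<^sub>1 g) \<circ>\<^sub>1 f) (h \<circ>\<^sub>1 (g \<circ>\<^sub>1 f)) (assoc C h g f)"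
    and assoc_natural:
      "\<lbrakk> h \<in> hom1 C c d; g \<in> hom1 C b c; f \<in> hom1 C a b;
         \<zeta> \<in> hom2 C h h'; \<kappa> \<in> hom2 C g g'; \<theta> \<in> hom2 C f f' \<rbrakk>
       \<Longrightarrow> assoc C h' g' f' \<cdot> ((\<zeta> \<circ>\<^sub>2 \<kappa>) \<circ>\<^sub>2 \<theta>) = (\<zeta> \<circ>\<^sub>2 (\<kappa> \<circ>\<^sub>2 \<theta>)) \<cdot> assoc C h g f"
    and lunit_invertible:
      "f \<in> hom1 C a b \<Longrightarrow> invertible2 C (id\<^sub>1 b \<circ>\<^sub>1 f) f (lunit C f)"
    and lunit_natural:
      "\<lbrakk> f \<in> hom1 C a b; \<theta> \<in> hom2 C f f' \<rbrakk>
       \<Longrightarrow> lunit C f' \<cdot> (id\<^sub>2 (id\<^sub>1 b) \<circ>\<^sub>2 \<theta>) = \<theta> \<cdot> lunit C f"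
    and runit_invertible:
      "f \<in> hom1 C a b \<Longrightarrow> invertible2 C (f \<circ>\<^sub>1 id\<^sub>1 a) f (runit C f)"
    and runit_natural:
      "\<lbrakk> f \<in> hom1 C a b; \<theta> \<in> hom2 C f f' \<rbrakk>
       \<Longrightarrow> runit C f' \<cdot> (\<theta> \<circ>\<^sub>2 id\<^sub>2 (id\<^sub>1 a)) = \<theta> \<cdot> runit C f"
    and pentagon:
      "\<lbrakk> k \<in> hom1 C d e; h \<in> hom1 C c d; g \<in> hom1 C b c; f \<in> hom1 C a b \<rbrakk>
       \<Longrightarrow> (id\<^sub>2 k \<circ>\<^sub>2 assoc C h g f) \<cdot> assoc C k (h \<circ>\<^sub>1 g) f \<cdot> (assoc C k h g \<circ>\<^sub>2 id\<^sub>2 f)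
         = assoc C k h (g \<circ>\<^sub>1 f) \<cdot> assoc C (k \<circ>\<^sub>1 h) g f"
    and triangle:
      "\<lbrakk> g \<in> hom1 C b c; f \<in> hom1 C a b \<rbrakk>
       \<Longrightarrow> (id\<^sub>2 g \<circ>\<^sub>2 lunit C f) \<cdot> assoc C g (id\<^sub>1 b) f = runit C g \<circ>\<^sub>2 id\<^sub>2 f"


section \<open>Strict monoidal bicategories\<close>

text \<open>
  The tensor product is a pseudofunctor from \<open>C \<times> C\<close> to \<open>C\<close>, with structure 2-morphisms
  \<open>tcomp g g' f f' : (g \<otimes> g') \<circ> (f \<otimes> f') \<Rightarrow> (g \<circ> f) \<otimes> (g' \<circ> f')\<close> and
  \<open>tid a b : id (a \<otimes> b) \<Rightarrow> id a \<otimes> id b\<close>.  The interchange isomorphism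
  \<open>(id \<otimes> g) \<circ> (f \<otimes> id) \<cong> (f \<otimes> id) \<circ> (id \<otimes> g)\<close> is not separate data: both sides are
  isomorphic to \<open>f \<otimes> g\<close> via \<open>tcomp\<close> and the unitors.
\<close>

record ('o, 'm, 't) monoidal_bicat = "('o, 'm, 't) bicat" +
  unit_obj :: "'o"  ("\<one>\<index>")
  tensor0 :: "'o \<Rightarrow> 'o \<Rightarrow> 'o"  (infixr "\<otimes>\<^sub>0\<index>" 75)
  tensor1 :: "'m \<Rightarrow> 'm \<Rightarrow> 'm"  (infixr "\<otimes>\<^sub>1\<index>" 75)
  tensor2 :: "'t \<Rightarrow> 't \<Rightarrow> 't"  (infixr "\<otimes>\<^sub>2\<index>" 75)
  tcomp :: "'m \<Rightarrow> 'm \<Rightarrow> 'm \<Rightarrow> 'm \<Rightarrow> 't"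
  tid :: "'o \<Rightarrow> 'o \<Rightarrow> 't"

locale tensor_bicategory = bicategory C
  for C :: "('o, 'm, 't, 'z) monoidal_bicat_scheme" (structure) +
  assumes unit_Obj: "\<one> \<in> Obj C"
    and tensor0_Obj: "\<lbrakk> a \<in> Obj C; a' \<in> Obj C \<rbrakk> \<Longrightarrow> a \<otimes>\<^sub>0 a' \<in> Obj C"
    and tensor1_hom:
      "\<lbrakk> f \<in> hom1 C a b; f' \<in> hom1 C a' b' \<rbrakk> \<Longrightarrow> f \<otimes>\<^sub>1 f' \<in> hom1 C (a \<otimes>\<^sub>0 a') (b \<otimes>\<^sub>0 b')"
    and tensor2_hom:
      "\<lbrakk> \<theta> \<in> hom2 C f g; \<theta>' \<in> hom2 C f' g' \<rbrakk> \<Longrightarrow> \<theta> \<otimes>\<^sub>2 \<theta>' \<in> hom2 C (f \<otimes>\<^sub>1 f') (g \<otimes>\<^sub>1 g')"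
    and tensor2_id:
      "\<lbrakk> f \<in> Mor1 C; f' \<in> Mor1 C \<rbrakk> \<Longrightarrow> id\<^sub>2 f \<otimes>\<^sub>2 id\<^sub>2 f' = id\<^sub>2 (f \<otimes>\<^sub>1 f')"
    and tensor2_vcomp:
      "\<lbrakk> \<kappa> \<in> hom2 C g h; \<theta> \<in> hom2 C f g; \<kappa>' \<in> hom2 C g' h'; \<theta>' \<in> hom2 C f' g' \<rbrakk>
       \<Longrightarrow> (\<kappa> \<cdot> \<theta>) \<otimes>\<^sub>2 (\<kappa>' \<cdot> \<theta>') = (\<kappa> \<otimes>\<^sub>2 \<kappa>') \<cdot> (\<theta> \<otimes>\<^sub>2 \<theta>')"
    and tcomp_invertible:
      "\<lbrakk> g \<in> hom1 C b c; f \<in> hom1 C a b; g' \<in> hom1 C b' c'; f' \<in> hom1 C a' b' \<rbrakk>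
       \<Longrightarrow> invertible2 C ((g \<otimes>\<^sub>1 g') \<circ>\<^sub>1 (f \<otimes>\<^sub>1 f')) ((g \<circ>\<^sub>1 f) \<otimes>\<^sub>1 (g' \<circ>\<^sub>1 f')) (tcomp C g g' f f')"
    and tcomp_natural:
      "\<lbrakk> g \<in> hom1 C b c; f \<in> hom1 C a b; g' \<in> hom1 C b' c'; f' \<in> hom1 C a' b';
         \<kappa> \<in> hom2 C g k; \<theta> \<in> hom2 C f h; \<kappa>' \<in> hom2 C g' k'; \<theta>' \<in> hom2 C f' h' \<rbrakk>
       \<Longrightarrow> tcomp C k k' h h' \<cdot> ((\<kappa> \<otimes>\<^sub>2 \<kappa>') \<circ>\<^sub>2 (\<theta> \<otimes>\<^sub>2 \<theta>'))
         = ((\<kappa> \<circ>\<^sub>2 \<theta>) \<otimes>\<^sub>2 (\<kappa>' \<circ>\<^sub>2 \<theta>')) \<cdot> tcomp C g g' f f'"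
    and tid_invertible:
      "\<lbrakk> a \<in> Obj C; a' \<in> Obj C \<rbrakk>
       \<Longrightarrow> invertible2 C (id\<^sub>1 (a \<otimes>\<^sub>0 a')) (id\<^sub>1 a \<otimes>\<^sub>1 id\<^sub>1 a') (tid C a a')"
    and tcomp_assoc:
      "\<lbrakk> h \<in> hom1 C c d; g \<in> hom1 C b c; f \<in> hom1 C a b;
         h' \<in> hom1 C c' d'; g' \<in> hom1 C b' c'; f' \<in> hom1 C a' b' \<rbrakk>
       \<Longrightarrow> (assoc C h g f \<otimes>\<^sub>2 assoc C h' g' f')
             \<cdot> tcomp C (h \<circ>\<^sub>1 g) (h' \<circ>\<^sub>1 g') f f' \<cdot> (tcomp C h h' g g' \<circ>\<^sub>2 id\<^sub>2 (f \<otimes>\<^sub>1 f'))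
         = tcomp C h h' (g \<circ>\<^sub>1 f) (g' \<circ>\<^sub>1 f') \<cdot> (id\<^sub>2 (h \<otimes>\<^sub>1 h') \<circ>\<^sub>2 tcomp C g g' f f')
             \<cdot> assoc C (h \<otimes>\<^sub>1 h') (g \<otimes>\<^sub>1 g') (f \<otimes>\<^sub>1 f')"
    and tcomp_lunit:
      "\<lbrakk> f \<in> hom1 C a b; f' \<in> hom1 C a' b' \<rbrakk>
       \<Longrightarrow> (lunit C f \<otimes>\<^sub>2 lunit C f') \<cdot> tcomp C (id\<^sub>1 b) (id\<^sub>1 b') f f'
             \<cdot> (tid C b b' \<circ>\<^sub>2 id\<^sub>2 (f \<otimes>\<^sub>1 f'))
         = lunit C (f \<otimes>\<^sub>1 f')"
    and tcomp_runit:
      "\<lbrakk> f \<in> hom1 C a b; f' \<in> hom1 C a' b' \<rbrakk>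
       \<Longrightarrow> (runit C f \<otimes>\<^sub>2 runit C f') \<cdot> tcomp C f f' (id\<^sub>1 a) (id\<^sub>1 a')
             \<cdot> (id\<^sub>2 (f \<otimes>\<^sub>1 f') \<circ>\<^sub>2 tid C a a')
         = runit C (f \<otimes>\<^sub>1 f')"

text \<open>
  Strictness means that the two pseudofunctors \<open>(x, y, z) \<mapsto> (x \<otimes> y) \<otimes> z\<close> and
  \<open>(x, y, z) \<mapsto> x \<otimes> (y \<otimes> z)\<close> coincide, and that \<open>\<one> \<otimes> -\<close> and \<open>- \<otimes> \<one>\<close> are the identity
  pseudofunctor, so that the associativity and unit constraints of a monoidal bicategory can be
  taken to be identities.  The underlying bicategory need not be a strict 2-category, nor need the
  tensor product be cubical; Gray monoids are a special case.  Equality of the pseudofunctors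
  includes equality of their structure 2-morphisms.  The compositor of \<open>\<one> \<otimes> -\<close> involves a unitor
  of \<open>C\<close>, since \<open>tcomp\<close> lands in \<open>(id \<one> \<circ> id \<one>) \<otimes> (g \<circ> f)\<close>.
\<close>

locale strict_monoidal_bicategory = tensor_bicategory +
  assumes tensor0_assoc:
      "\<lbrakk> a \<in> Obj C; b \<in> Obj C; c \<in> Obj C \<rbrakk> \<Longrightarrow> (a \<otimes>\<^sub>0 b) \<otimes>\<^sub>0 c = a \<otimes>\<^sub>0 (b \<otimes>\<^sub>0 c)"
    and tensor1_assoc:
      "\<lbrakk> f \<in> Mor1 C; g \<in> Mor1 C; h \<in> Mor1 C \<rbrakk> \<Longrightarrow> (f \<otimes>\<^sub>1 g) \<otimes>\<^sub>1 h = f \<otimes>\<^sub>1 (g \<otimes>\<^sub>1 h)"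
    and tensor2_assoc:
      "\<lbrakk> \<theta> \<in> Mor2 C; \<kappa> \<in> Mor2 C; \<zeta> \<in> Mor2 C \<rbrakk> \<Longrightarrow> (\<theta> \<otimes>\<^sub>2 \<kappa>) \<otimes>\<^sub>2 \<zeta> = \<theta> \<otimes>\<^sub>2 (\<kappa> \<otimes>\<^sub>2 \<zeta>)"
    and tcomp_tensor_assoc:
      "\<lbrakk> g \<in> hom1 C b c; f \<in> hom1 C a b; g' \<in> hom1 C b' c'; f' \<in> hom1 C a' b';
         g'' \<in> hom1 C b'' c''; f'' \<in> hom1 C a'' b'' \<rbrakk>
       \<Longrightarrow> (tcomp C g g' f f' \<otimes>\<^sub>2 id\<^sub>2 (g'' \<circ>\<^sub>1 f'')) \<cdot> tcomp C (g \<otimes>\<^sub>1 g') g'' (f \<otimes>\<^sub>1 f') f''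
         = (id\<^sub>2 (g \<circ>\<^sub>1 f) \<otimes>\<^sub>2 tcomp C g' g'' f' f'') \<cdot> tcomp C g (g' \<otimes>\<^sub>1 g'') f (f' \<otimes>\<^sub>1 f'')"
    and tid_tensor_assoc:
      "\<lbrakk> a \<in> Obj C; b \<in> Obj C; c \<in> Obj C \<rbrakk>
       \<Longrightarrow> (tid C a b \<otimes>\<^sub>2 id\<^sub>2 (id\<^sub>1 c)) \<cdot> tid C (a \<otimes>\<^sub>0 b) c
         = (id\<^sub>2 (id\<^sub>1 a) \<otimes>\<^sub>2 tid C b c) \<cdot> tid C a (b \<otimes>\<^sub>0 c)"
    and tensor0_unit_left: "a \<in> Obj C \<Longrightarrow> \<one> \<otimes>\<^sub>0 a = a"
    and tensor0_unit_right: "a \<in> Obj C \<Longrightarrow> a \<otimes>\<^sub>0 \<one> = a"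
    and tensor1_unit_left: "f \<in> Mor1 C \<Longrightarrow> id\<^sub>1 \<one> \<otimes>\<^sub>1 f = f"
    and tensor1_unit_right: "f \<in> Mor1 C \<Longrightarrow> f \<otimes>\<^sub>1 id\<^sub>1 \<one> = f"
    and tensor2_unit_left: "\<theta> \<in> Mor2 C \<Longrightarrow> id\<^sub>2 (id\<^sub>1 \<one>) \<otimes>\<^sub>2 \<theta> = \<theta>"
    and tensor2_unit_right: "\<theta> \<in> Mor2 C \<Longrightarrow> \<theta> \<otimes>\<^sub>2 id\<^sub>2 (id\<^sub>1 \<one>) = \<theta>"
    and tcomp_unit_left:
      "\<lbrakk> g \<in> hom1 C b c; f \<in> hom1 C a b \<rbrakk>
       \<Longrightarrow> (lunit C (id\<^sub>1 \<one>) \<otimes>\<^sub>2 id\<^sub>2 (g \<circ>\<^sub>1 f)) \<cdot> tcomp C (id\<^sub>1 \<one>) g (id\<^sub>1 \<one>) f = id\<^sub>2 (g \<circ>\<^sub>1 f)"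
    and tcomp_unit_right:
      "\<lbrakk> g \<in> hom1 C b c; f \<in> hom1 C a b \<rbrakk>
       \<Longrightarrow> (id\<^sub>2 (g \<circ>\<^sub>1 f) \<otimes>\<^sub>2 lunit C (id\<^sub>1 \<one>)) \<cdot> tcomp C g (id\<^sub>1 \<one>) f (id\<^sub>1 \<one>) = id\<^sub>2 (g \<circ>\<^sub>1 f)"
    and tid_unit_left: "a \<in> Obj C \<Longrightarrow> tid C \<one> a = id\<^sub>2 (id\<^sub>1 a)"
    and tid_unit_right: "a \<in> Obj C \<Longrightarrow> tid C a \<one> = id\<^sub>2 (id\<^sub>1 a)"


section \<open>Biexact pairings\<close>

text \<open>
  The composites below are well typed because the tensor product is strict: for instance
  \<open>\<eta> \<otimes> id y\<close> goes from \<open>y = \<one> \<otimes> y\<close> to \<open>(y \<otimes> x) \<otimes> y = y \<otimes> (x \<otimes> y)\<close>.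
\<close>

definition biexact_pairing ::
    "('o, 'm, 't, 'z) monoidal_bicat_scheme \<Rightarrow> 'o \<Rightarrow> 'o \<Rightarrow> 'm \<Rightarrow> 'm \<Rightarrow> bool"
  where "biexact_pairing C x y \<epsilon> \<eta> \<longleftrightarrow>
    x \<in> Obj C \<and> y \<in> Obj C \<and>
    \<epsilon> \<in> hom1 C (x \<otimes>\<^sub>0\<^bsub>C\<^esub> y) \<one>\<^bsub>C\<^esub> \<and>
    \<eta> \<in> hom1 C \<one>\<^bsub>C\<^esub> (y \<otimes>\<^sub>0\<^bsub>C\<^esub> x) \<and>
    (id\<^sub>1\<^bsub>C\<^esub> y \<otimes>\<^sub>1\<^bsub>C\<^esub> \<epsilon>) \<circ>\<^sub>1\<^bsub>C\<^esub> (\<eta> \<otimes>\<^sub>1\<^bsub>C\<^esub> id\<^sub>1\<^bsub>C\<^esub> y) \<cong>\<^bsub>C\<^esub> id\<^sub>1\<^bsub>C\<^esub> y \<and>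
    id\<^sub>1\<^bsub>C\<^esub> x \<cong>\<^bsub>C\<^esub> (\<epsilon> \<otimes>\<^sub>1\<^bsub>C\<^esub> id\<^sub>1\<^bsub>C\<^esub> x) \<circ>\<^sub>1\<^bsub>C\<^esub> (id\<^sub>1\<^bsub>C\<^esub> x \<otimes>\<^sub>1\<^bsub>C\<^esub> \<eta>)"

definition preserves_pairing ::
    "('o, 'm, 't, 'z) monoidal_bicat_scheme \<Rightarrow> 'o \<Rightarrow> 'm \<Rightarrow> 'm \<Rightarrow> 'm \<Rightarrow> 'm \<Rightarrow> 'm \<Rightarrow> bool"
  where "preserves_pairing C x \<epsilon> \<eta> \<epsilon>' \<eta>' \<alpha> \<longleftrightarrow>
    \<epsilon>' \<circ>\<^sub>1\<^bsub>C\<^esub> (id\<^sub>1\<^bsub>C\<^esub> x \<otimes>\<^sub>1\<^bsub>C\<^esub> \<alpha>) \<cong>\<^bsub>C\<^esub> \<epsilon> \<and>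
    (\<alpha> \<otimes>\<^sub>1\<^bsub>C\<^esub> id\<^sub>1\<^bsub>C\<^esub> x) \<circ>\<^sub>1\<^bsub>C\<^esub> \<eta> \<cong>\<^bsub>C\<^esub> \<eta>'"

end

theory Submission imports Defs begin

text \<open>
  Up to invertible 2-morphisms this is the uniqueness of duals in a strict monoidal category.
  The comparison \<open>\<alpha> = (id B' \<otimes> \<epsilon>) \<circ> (\<eta>' \<otimes> id B)\<close> preserves evaluation and coevaluation by the zigzag
  identities, and every 1-morphism \<open>B \<rightarrow> B'\<close> that preserves evaluation is isomorphic to it.
  If \<open>\<beta>\<close> is the comparison in the other direction, then \<open>\<beta> \<circ> \<alpha>\<close> preserves the evaluation
  of \<open>A \<stileturn> B\<close>, so it is isomorphic to the comparison of
  this pairing with itself, which is isomorphic to \<open>id B\<close> by a zigzag identity.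
\<close>

section \<open>Isomorphism of 1-morphisms as a congruence for composition\<close>

context bicategory
begin

text \<open>A 2-morphism only runs between parallel 1-morphisms, so typing transfers along
  \<open>\<cong>\<close>. This lets the congruence rules below ask for typing on one side
  only.\<close>

lemma iso1_hom1:
  assumes "f \<cong> g"
  shows "f \<in> hom1 C a b \<longleftrightarrow> g \<in> hom1 C a b"
  using assms src2_Mor1 trg2_Mor1 src_parallel trg_parallel
  unfolding isomorphic1_def invertible2_def hom1_def hom2_def by fastforce

lemma iso1_refl: "f \<in> hom1 C a b \<Longrightarrow> f \<cong> f"
  unfolding isomorphic1_def invertible2_def hom1_def
  using id2_hom vcomp_id_left by blast

lemma iso1_sym: "f \<cong> g \<Longrightarrow> g \<cong> f"
  unfolding isomorphic1_def invertible2_def by blast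

text \<open>One of the two equations that make a vertical composite invertible.
  \<open>iso1_trans\<close> obtains the other from it by exchanging the 2-morphisms with their
  inverses.\<close>

lemma vcomp_inverse:
  assumes \<theta>: "\<theta> \<in> hom2 C f g" and \<theta>': "\<theta>' \<in> hom2 C g f"
    and \<kappa>: "\<kappa> \<in> hom2 C g h" and \<kappa>': "\<kappa>' \<in> hom2 C h g"
    and "\<theta>' \<cdot> \<theta> = id\<^sub>2 f" and "\<kappa>' \<cdot> \<kappa> = id\<^sub>2 g"
  shows "(\<theta>' \<cdot> \<kappa>') \<cdot> (\<kappa> \<cdot> \<theta>) = id\<^sub>2 f"
proof -
  have "(\<theta>' \<cdot> \<kappa>') \<cdot> (\<kappa> \<cdot> \<theta>) = \<theta>' \<cdot> ((\<kappa>' \<cdot> \<kappa>) \<cdot> \<theta>)"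
    using vcomp_assoc[OF \<theta>' \<kappa>' vcomp_hom[OF \<kappa> \<theta>]] vcomp_assoc[OF \<kappa>' \<kappa> \<theta>] by simp
  then show ?thesis
    using assms vcomp_id_left[OF \<theta>] by simp
qed

lemma iso1_trans [trans]:
  assumes "f \<cong> g" and "g \<cong> h"
  shows "f \<cong> h"
proof -
  obtain \<theta> \<theta>' where \<theta>: "\<theta> \<in> hom2 C f g" "\<theta>' \<in> hom2 C g f" "\<theta>' \<cdot> \<theta> = id\<^sub>2 f" "\<theta> \<cdot> \<theta>' = id\<^sub>2 g"
    using assms(1) unfolding isomorphic1_def invertible2_def by blast
  obtain \<kappa> \<kappa>' where \<kappa>: "\<kappa> \<in> hom2 C g h" "\<kappa>' \<in> hom2 C h g" "\<kappa>' \<cdot> \<kappa> = id\<^sub>2 g" "\<kappa> \<cdot> \<kappa>' = id\<^sub>2 h"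
    using assms(2) unfolding isomorphic1_def invertible2_def by blast
  have "(\<theta>' \<cdot> \<kappa>') \<cdot> (\<kappa> \<cdot> \<theta>) = id\<^sub>2 f" "(\<kappa> \<cdot> \<theta>) \<cdot> (\<theta>' \<cdot> \<kappa>') = id\<^sub>2 h"
    using \<theta> \<kappa> by (auto intro!: vcomp_inverse)
  then show ?thesis
    using \<theta> \<kappa> vcomp_hom unfolding isomorphic1_def invertible2_def by blast
qed

text \<open>The inverse is the horizontal composite of the inverses, by functoriality of
  \<open>\<circ>\<^sub>2\<close>.\<close>

lemma iso1_comp:
  assumes "g \<cong> g'" and "f \<cong> f'" and g: "g \<in> hom1 C b c" and f: "f \<in> hom1 C a b"
  shows "g \<circ>\<^sub>1 f \<cong> g' \<circ>\<^sub>1 f'"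
proof -
  have g': "g' \<in> hom1 C b c" and f': "f' \<in> hom1 C a b"
    using assms iso1_hom1 by blast+
  obtain \<kappa> \<kappa>' where \<kappa>: "\<kappa> \<in> hom2 C g g'" "\<kappa>' \<in> hom2 C g' g" "\<kappa>' \<cdot> \<kappa> = id\<^sub>2 g" "\<kappa> \<cdot> \<kappa>' = id\<^sub>2 g'"
    using assms(1) unfolding isomorphic1_def invertible2_def by blast
  obtain \<theta> \<theta>' where \<theta>: "\<theta> \<in> hom2 C f f'" "\<theta>' \<in> hom2 C f' f" "\<theta>' \<cdot> \<theta> = id\<^sub>2 f" "\<theta> \<cdot> \<theta>' = id\<^sub>2 f'"
    using assms(2) unfolding isomorphic1_def invertible2_def by blast
  have "(\<kappa>' \<circ>\<^sub>2 \<theta>') \<cdot> (\<kappa> \<circ>\<^sub>2 \<theta>) = id\<^sub>2 (g \<circ>\<^sub>1 f)"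
    using hcomp_vcomp[OF g f \<kappa>(1,2) \<theta>(1,2)] hcomp_id[OF g f] \<kappa> \<theta> by simp
  moreover have "(\<kappa> \<circ>\<^sub>2 \<theta>) \<cdot> (\<kappa>' \<circ>\<^sub>2 \<theta>') = id\<^sub>2 (g' \<circ>\<^sub>1 f')"
    using hcomp_vcomp[OF g' f' \<kappa>(2,1) \<theta>(2,1)] hcomp_id[OF g' f'] \<kappa> \<theta> by simp
  ultimately show ?thesis
    using hcomp_hom[OF g f \<kappa>(1) \<theta>(1)] hcomp_hom[OF g' f' \<kappa>(2) \<theta>(2)]
    unfolding isomorphic1_def invertible2_def by blast
qed

lemma iso1_comp_left:
  "\<lbrakk> f \<cong> f'; g \<in> hom1 C b c; f \<in> hom1 C a b \<rbrakk> \<Longrightarrow> g \<circ>\<^sub>1 f \<cong> g \<circ>\<^sub>1 f'"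
  by (rule iso1_comp[OF iso1_refl])

lemma iso1_comp_right:
  "\<lbrakk> g \<cong> g'; g \<in> hom1 C b c; f \<in> hom1 C a b \<rbrakk> \<Longrightarrow> g \<circ>\<^sub>1 f \<cong> g' \<circ>\<^sub>1 f"
  by (rule iso1_comp[OF _ iso1_refl])

lemma iso1_assoc:
  "\<lbrakk> h \<in> hom1 C c d; g \<in> hom1 C b c; f \<in> hom1 C a b \<rbrakk> \<Longrightarrow> (h \<circ>\<^sub>1 g) \<circ>\<^sub>1 f \<cong> h \<circ>\<^sub>1 (g \<circ>\<^sub>1 f)"
  using assoc_invertible unfolding isomorphic1_def by blast

lemma iso1_lunit: "f \<in> hom1 C a b \<Longrightarrow> id\<^sub>1 b \<circ>\<^sub>1 f \<cong> f"
  using lunit_invertible unfolding isomorphic1_def by blast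

lemma iso1_runit: "f \<in> hom1 C a b \<Longrightarrow> f \<circ>\<^sub>1 id\<^sub>1 a \<cong> f"
  using runit_invertible unfolding isomorphic1_def by blast

lemma hom1D: "f \<in> hom1 C a b \<Longrightarrow> f \<in> Mor1 C \<and> a \<in> Obj C \<and> b \<in> Obj C"
  using src1_Obj trg1_Obj unfolding hom1_def by blast

end

section \<open>Tensor products and interchange up to isomorphism\<close>

context tensor_bicategory
begin

text \<open>\<open>\<otimes>\<^sub>2\<close> is functorial for vertical composition, so it carries a
  pair of mutual inverses to a pair of mutual inverses.\<close>

lemma iso1_tensor:
  assumes "f \<cong> g" and "f' \<cong> g'"
  shows "f \<otimes>\<^sub>1 f' \<cong> g \<otimes>\<^sub>1 g'"
proof -
  obtain \<theta> \<theta>' where \<theta>: "\<theta> \<in> hom2 C f g" "\<theta>' \<in> hom2 C g f" "\<theta>' \<cdot> \<theta> = id\<^sub>2 f" "\<theta> \<cdot> \<theta>' = id\<^sub>2 g"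
    using assms(1) unfolding isomorphic1_def invertible2_def by blast
  obtain \<kappa> \<kappa>' where \<kappa>: "\<kappa> \<in> hom2 C f' g'" "\<kappa>' \<in> hom2 C g' f'" "\<kappa>' \<cdot> \<kappa> = id\<^sub>2 f'" "\<kappa> \<cdot> \<kappa>' = id\<^sub>2 g'"
    using assms(2) unfolding isomorphic1_def invertible2_def by blast
  have "f \<in> Mor1 C" "g \<in> Mor1 C" "f' \<in> Mor1 C" "g' \<in> Mor1 C"
    using \<theta>(1) \<kappa>(1) src2_Mor1 trg2_Mor1 unfolding hom2_def by auto
  then have "(\<theta>' \<otimes>\<^sub>2 \<kappa>') \<cdot> (\<theta> \<otimes>\<^sub>2 \<kappa>) = id\<^sub>2 (f \<otimes>\<^sub>1 f')"
    "(\<theta> \<otimes>\<^sub>2 \<kappa>) \<cdot> (\<theta>' \<otimes>\<^sub>2 \<kappa>') = id\<^sub>2 (g \<otimes>\<^sub>1 g')"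
    using tensor2_vcomp[OF \<theta>(2,1) \<kappa>(2,1)] tensor2_vcomp[OF \<theta>(1,2) \<kappa>(1,2)] tensor2_id \<theta> \<kappa> by simp_all
  then show ?thesis
    using tensor2_hom[OF \<theta>(1) \<kappa>(1)] tensor2_hom[OF \<theta>(2) \<kappa>(2)]
    unfolding isomorphic1_def invertible2_def by blast
qed

lemma iso1_tensor_left: "\<lbrakk> f \<cong> g; x \<in> Obj C \<rbrakk> \<Longrightarrow> id\<^sub>1 x \<otimes>\<^sub>1 f \<cong> id\<^sub>1 x \<otimes>\<^sub>1 g"
  by (rule iso1_tensor[OF iso1_refl[OF id1_hom]])

lemma iso1_tensor_right: "\<lbrakk> f \<cong> g; x \<in> Obj C \<rbrakk> \<Longrightarrow> f \<otimes>\<^sub>1 id\<^sub>1 x \<cong> g \<otimes>\<^sub>1 id\<^sub>1 x"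
  by (rule iso1_tensor[OF _ iso1_refl[OF id1_hom]])

lemma iso1_interchange:
  "\<lbrakk> g \<in> hom1 C b c; f \<in> hom1 C a b; g' \<in> hom1 C b' c'; f' \<in> hom1 C a' b' \<rbrakk>
   \<Longrightarrow> (g \<otimes>\<^sub>1 g') \<circ>\<^sub>1 (f \<otimes>\<^sub>1 f') \<cong> (g \<circ>\<^sub>1 f) \<otimes>\<^sub>1 (g' \<circ>\<^sub>1 f')"
  using tcomp_invertible unfolding isomorphic1_def by blast

lemma iso1_tensor_id:
  "\<lbrakk> a \<in> Obj C; b \<in> Obj C \<rbrakk> \<Longrightarrow> id\<^sub>1 a \<otimes>\<^sub>1 id\<^sub>1 b \<cong> id\<^sub>1 (a \<otimes>\<^sub>0 b)"
  using tid_invertible iso1_sym unfolding isomorphic1_def by blast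

text \<open>The compositor of the tensor product leaves
  \<open>id\<^sub>1 x \<circ>\<^sub>1 id\<^sub>1 x\<close> in the whiskered factor, and a unitor
  contracts it. The next lemma is the same on the other side.\<close>

lemma iso1_whisker_left_comp:
  assumes "g \<in> hom1 C b c" and "f \<in> hom1 C a b" and x: "x \<in> Obj C"
  shows "id\<^sub>1 x \<otimes>\<^sub>1 (g \<circ>\<^sub>1 f) \<cong> (id\<^sub>1 x \<otimes>\<^sub>1 g) \<circ>\<^sub>1 (id\<^sub>1 x \<otimes>\<^sub>1 f)"
proof (rule iso1_sym, rule iso1_trans)
  show "(id\<^sub>1 x \<otimes>\<^sub>1 g) \<circ>\<^sub>1 (id\<^sub>1 x \<otimes>\<^sub>1 f) \<cong> (id\<^sub>1 x \<circ>\<^sub>1 id\<^sub>1 x) \<otimes>\<^sub>1 (g \<circ>\<^sub>1 f)"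
    using assms by (blast intro: iso1_interchange id1_hom)
  show "(id\<^sub>1 x \<circ>\<^sub>1 id\<^sub>1 x) \<otimes>\<^sub>1 (g \<circ>\<^sub>1 f) \<cong> id\<^sub>1 x \<otimes>\<^sub>1 (g \<circ>\<^sub>1 f)"
    using assms by (blast intro: iso1_tensor iso1_lunit id1_hom iso1_refl comp1_hom)
qed

lemma iso1_whisker_right_comp:
  assumes "g \<in> hom1 C b c" and "f \<in> hom1 C a b" and x: "x \<in> Obj C"
  shows "(g \<circ>\<^sub>1 f) \<otimes>\<^sub>1 id\<^sub>1 x \<cong> (g \<otimes>\<^sub>1 id\<^sub>1 x) \<circ>\<^sub>1 (f \<otimes>\<^sub>1 id\<^sub>1 x)"
proof (rule iso1_sym, rule iso1_trans)
  show "(g \<otimes>\<^sub>1 id\<^sub>1 x) \<circ>\<^sub>1 (f \<otimes>\<^sub>1 id\<^sub>1 x) \<cong> (g \<circ>\<^sub>1 f) \<otimes>\<^sub>1 (id\<^sub>1 x \<circ>\<^sub>1 id\<^sub>1 x)"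
    using assms by (blast intro: iso1_interchange id1_hom)
  show "(g \<circ>\<^sub>1 f) \<otimes>\<^sub>1 (id\<^sub>1 x \<circ>\<^sub>1 id\<^sub>1 x) \<cong> (g \<circ>\<^sub>1 f) \<otimes>\<^sub>1 id\<^sub>1 x"
    using assms by (blast intro: iso1_tensor iso1_lunit id1_hom iso1_refl comp1_hom)
qed

text \<open>Both sides are isomorphic to \<open>f \<otimes>\<^sub>1 g\<close>, by the compositor and
  the unitors. This is the interchange isomorphism of a strict monoidal bicategory, and the means of
  moving one 1-morphism past another in all later arguments.\<close>

lemma iso1_slide:
  assumes f: "f \<in> hom1 C a b" and g: "g \<in> hom1 C c d"
  shows "(f \<otimes>\<^sub>1 id\<^sub>1 d) \<circ>\<^sub>1 (id\<^sub>1 a \<otimes>\<^sub>1 g) \<cong> (id\<^sub>1 b \<otimes>\<^sub>1 g) \<circ>\<^sub>1 (f \<otimes>\<^sub>1 id\<^sub>1 c)"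
proof -
  have ids: "id\<^sub>1 a \<in> hom1 C a a" "id\<^sub>1 b \<in> hom1 C b b" "id\<^sub>1 c \<in> hom1 C c c" "id\<^sub>1 d \<in> hom1 C d d"
    using f g hom1D id1_hom by blast+
  have "(f \<otimes>\<^sub>1 id\<^sub>1 d) \<circ>\<^sub>1 (id\<^sub>1 a \<otimes>\<^sub>1 g) \<cong> (f \<circ>\<^sub>1 id\<^sub>1 a) \<otimes>\<^sub>1 (id\<^sub>1 d \<circ>\<^sub>1 g)"
    using f g ids by (blast intro: iso1_interchange)
  also have "\<dots> \<cong> f \<otimes>\<^sub>1 g"
    using f g by (blast intro: iso1_tensor iso1_lunit iso1_runit)
  also have "\<dots> \<cong> (id\<^sub>1 b \<circ>\<^sub>1 f) \<otimes>\<^sub>1 (g \<circ>\<^sub>1 id\<^sub>1 c)"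
    using f g by (blast intro: iso1_sym iso1_tensor iso1_lunit iso1_runit)
  also have "\<dots> \<cong> (id\<^sub>1 b \<otimes>\<^sub>1 g) \<circ>\<^sub>1 (f \<otimes>\<^sub>1 id\<^sub>1 c)"
    using f g ids by (blast intro: iso1_sym iso1_interchange)
  finally show ?thesis .
qed

end

section \<open>Strict whiskering and the comparison of two pairings with the same left
  object\<close>

context strict_monoidal_bicategory
begin

text \<open>Strict associativity gives an equality with \<open>(id\<^sub>1 x \<otimes>\<^sub>1
  id\<^sub>1 y) \<otimes>\<^sub>1 f\<close>. The remaining step is only an isomorphism, because
  \<open>\<otimes>\<close> preserves identity 1-morphisms up to \<open>tid\<close>.\<close>

lemma iso1_whisker_left_left:
  assumes "f \<in> hom1 C a b" and "x \<in> Obj C" and "y \<in> Obj C"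
  shows "id\<^sub>1 x \<otimes>\<^sub>1 (id\<^sub>1 y \<otimes>\<^sub>1 f) \<cong> id\<^sub>1 (x \<otimes>\<^sub>0 y) \<otimes>\<^sub>1 f"
proof -
  have "id\<^sub>1 x \<otimes>\<^sub>1 (id\<^sub>1 y \<otimes>\<^sub>1 f) = (id\<^sub>1 x \<otimes>\<^sub>1 id\<^sub>1 y) \<otimes>\<^sub>1 f"
    using assms by (metis hom1D id1_hom tensor1_assoc)
  then show ?thesis
    using assms iso1_tensor[OF iso1_tensor_id iso1_refl] by metis
qed

lemma iso1_whisker_right_right:
  assumes "f \<in> hom1 C a b" and "x \<in> Obj C" and "y \<in> Obj C"
  shows "(f \<otimes>\<^sub>1 id\<^sub>1 x) \<otimes>\<^sub>1 id\<^sub>1 y \<cong> f \<otimes>\<^sub>1 id\<^sub>1 (x \<otimes>\<^sub>0 y)"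
proof -
  have "(f \<otimes>\<^sub>1 id\<^sub>1 x) \<otimes>\<^sub>1 id\<^sub>1 y = f \<otimes>\<^sub>1 (id\<^sub>1 x \<otimes>\<^sub>1 id\<^sub>1 y)"
    using assms by (metis hom1D id1_hom tensor1_assoc)
  then show ?thesis
    using assms iso1_tensor[OF iso1_refl iso1_tensor_id] by metis
qed

lemma whisker_assoc:
  "\<lbrakk> f \<in> hom1 C a b; x \<in> Obj C; y \<in> Obj C \<rbrakk>
   \<Longrightarrow> (id\<^sub>1 x \<otimes>\<^sub>1 f) \<otimes>\<^sub>1 id\<^sub>1 y = id\<^sub>1 x \<otimes>\<^sub>1 (f \<otimes>\<^sub>1 id\<^sub>1 y)"
  by (metis hom1D id1_hom tensor1_assoc)

lemma whisker_left_hom: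
  "\<lbrakk> f \<in> hom1 C a b; x \<in> Obj C \<rbrakk> \<Longrightarrow> id\<^sub>1 x \<otimes>\<^sub>1 f \<in> hom1 C (x \<otimes>\<^sub>0 a) (x \<otimes>\<^sub>0 b)"
  by (blast intro: tensor1_hom id1_hom)

lemma whisker_right_hom:
  "\<lbrakk> f \<in> hom1 C a b; x \<in> Obj C \<rbrakk> \<Longrightarrow> f \<otimes>\<^sub>1 id\<^sub>1 x \<in> hom1 C (a \<otimes>\<^sub>0 x) (b \<otimes>\<^sub>0 x)"
  by (blast intro: tensor1_hom id1_hom)

text \<open>Strictness on objects absorbs the factor \<open>\<one>\<close> and the bracketing, so
  that whiskered evaluations, and below whiskered coevaluations, compose without coherence
  1-morphisms.\<close>

lemma ev_whisker_hom:
  assumes "\<epsilon> \<in> hom1 C (x \<otimes>\<^sub>0 y) \<one>" and "x \<in> Obj C" and "y \<in> Obj C" and "z \<in> Obj C"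
  shows "id\<^sub>1 z \<otimes>\<^sub>1 \<epsilon> \<in> hom1 C (z \<otimes>\<^sub>0 x \<otimes>\<^sub>0 y) z"
    and "\<epsilon> \<otimes>\<^sub>1 id\<^sub>1 z \<in> hom1 C (x \<otimes>\<^sub>0 y \<otimes>\<^sub>0 z) z"
  using assms whisker_left_hom[OF assms(1,4)] whisker_right_hom[OF assms(1,4)]
  by (auto simp: tensor0_assoc tensor0_unit_left tensor0_unit_right)

lemma coev_whisker_hom:
  assumes "\<eta> \<in> hom1 C \<one> (y \<otimes>\<^sub>0 x)" and "x \<in> Obj C" and "y \<in> Obj C" and "z \<in> Obj C"
  shows "id\<^sub>1 z \<otimes>\<^sub>1 \<eta> \<in> hom1 C z (z \<otimes>\<^sub>0 y \<otimes>\<^sub>0 x)"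
    and "\<eta> \<otimes>\<^sub>1 id\<^sub>1 z \<in> hom1 C z (y \<otimes>\<^sub>0 x \<otimes>\<^sub>0 z)"
  using assms whisker_left_hom[OF assms(1,4)] whisker_right_hom[OF assms(1,4)]
  by (auto simp: tensor0_assoc tensor0_unit_left tensor0_unit_right)

text \<open>The mate of the identity of \<open>x\<close> under two pairings of \<open>x\<close>,
  with \<open>y\<close> and with \<open>y'\<close>: the path
  \<open>y \<rightarrow> y' \<otimes> x \<otimes> y \<rightarrow> y'\<close>. It takes the
  evaluation from the source pairing and the coevaluation from the target pairing. Here
  \<open>'a\<close> and \<open>'b\<close> are the types of objects and 1-morphisms of
  \<open>C\<close>.\<close>

definition comparison :: "'a \<Rightarrow> 'a \<Rightarrow> 'b \<Rightarrow> 'b \<Rightarrow> 'b"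
  where "comparison y y' \<epsilon> \<eta>' = (id\<^sub>1 y' \<otimes>\<^sub>1 \<epsilon>) \<circ>\<^sub>1 (\<eta>' \<otimes>\<^sub>1 id\<^sub>1 y)"

lemma comparison_hom:
  assumes "biexact_pairing C x y \<epsilon> \<eta>" and "biexact_pairing C x y' \<epsilon>' \<eta>'"
  shows "comparison y y' \<epsilon> \<eta>' \<in> hom1 C y y'"
  using assms ev_whisker_hom coev_whisker_hom comp1_hom
  unfolding comparison_def biexact_pairing_def by metis

lemma comparison_self: "biexact_pairing C x y \<epsilon> \<eta> \<Longrightarrow> comparison y y \<epsilon> \<eta> \<cong> id\<^sub>1 y"
  unfolding comparison_def biexact_pairing_def by blast

text \<open>In the comparison, replace \<open>\<epsilon>\<close> by
  \<open>\<epsilon>' \<circ> (id \<otimes> \<alpha>)\<close> and slide \<alpha> to the right past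
  \<open>\<eta>'\<close>. What remains to the left of \<alpha> is the zigzag of the second pairing
  at \<open>y'\<close>.\<close>

lemma comparison_unique:
  assumes p: "biexact_pairing C x y \<epsilon> \<eta>" and p': "biexact_pairing C x y' \<epsilon>' \<eta>'"
    and \<alpha>: "\<alpha> \<in> hom1 C y y'" and ev: "\<epsilon>' \<circ>\<^sub>1 (id\<^sub>1 x \<otimes>\<^sub>1 \<alpha>) \<cong> \<epsilon>"
  shows "comparison y y' \<epsilon> \<eta>' \<cong> \<alpha>"
proof -
  have o: "x \<in> Obj C" "y \<in> Obj C" "y' \<in> Obj C" "y' \<otimes>\<^sub>0 x \<in> Obj C"
    using p p' tensor0_Obj unfolding biexact_pairing_def by auto
  have \<epsilon>: "\<epsilon> \<in> hom1 C (x \<otimes>\<^sub>0 y) \<one>" and \<epsilon>': "\<epsilon>' \<in> hom1 C (x \<otimes>\<^sub>0 y') \<one>"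
    and \<eta>': "\<eta>' \<in> hom1 C \<one> (y' \<otimes>\<^sub>0 x)"
    and zigzag: "(id\<^sub>1 y' \<otimes>\<^sub>1 \<epsilon>') \<circ>\<^sub>1 (\<eta>' \<otimes>\<^sub>1 id\<^sub>1 y') \<cong> id\<^sub>1 y'"
    using p p' unfolding biexact_pairing_def by auto
  note h = ev_whisker_hom(1)[OF \<epsilon> o(1,2,3)] ev_whisker_hom(1)[OF \<epsilon>' o(1,3,3)]
    coev_whisker_hom(2)[OF \<eta>' o(1,3,2)] coev_whisker_hom(2)[OF \<eta>' o(1,3,3)]
  have x\<alpha>: "id\<^sub>1 x \<otimes>\<^sub>1 \<alpha> \<in> hom1 C (x \<otimes>\<^sub>0 y) (x \<otimes>\<^sub>0 y')"
    using \<alpha> o whisker_left_hom by blast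
  have y'x\<alpha>: "id\<^sub>1 (y' \<otimes>\<^sub>0 x) \<otimes>\<^sub>1 \<alpha> \<in> hom1 C (y' \<otimes>\<^sub>0 x \<otimes>\<^sub>0 y) (y' \<otimes>\<^sub>0 x \<otimes>\<^sub>0 y')"
    using whisker_left_hom[OF \<alpha> o(4)] o by (simp add: tensor0_assoc)
  have "id\<^sub>1 y' \<otimes>\<^sub>1 \<epsilon> \<cong> id\<^sub>1 y' \<otimes>\<^sub>1 (\<epsilon>' \<circ>\<^sub>1 (id\<^sub>1 x \<otimes>\<^sub>1 \<alpha>))"
    using iso1_tensor_left[OF iso1_sym[OF ev]] o by blast
  also have "\<dots> \<cong> (id\<^sub>1 y' \<otimes>\<^sub>1 \<epsilon>') \<circ>\<^sub>1 (id\<^sub>1 y' \<otimes>\<^sub>1 (id\<^sub>1 x \<otimes>\<^sub>1 \<alpha>))"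
    using iso1_whisker_left_comp[OF \<epsilon>' x\<alpha>] o by blast
  also have "\<dots> \<cong> (id\<^sub>1 y' \<otimes>\<^sub>1 \<epsilon>') \<circ>\<^sub>1 (id\<^sub>1 (y' \<otimes>\<^sub>0 x) \<otimes>\<^sub>1 \<alpha>)"
    using iso1_comp_left[OF iso1_whisker_left_left[OF \<alpha>] h(2)] o whisker_left_hom[OF x\<alpha>] by blast
  finally have *: "id\<^sub>1 y' \<otimes>\<^sub>1 \<epsilon> \<cong> (id\<^sub>1 y' \<otimes>\<^sub>1 \<epsilon>') \<circ>\<^sub>1 (id\<^sub>1 (y' \<otimes>\<^sub>0 x) \<otimes>\<^sub>1 \<alpha>)" .
  \<comment> \<open>Since \<open>\<eta>'\<close> starts at \<open>\<one>\<close>, the slid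
    1-morphism is \<open>id\<^sub>1 \<one> \<otimes>\<^sub>1 \<alpha>\<close>, which strictness
    makes equal to \<alpha>.\<close>
  have slide: "(id\<^sub>1 (y' \<otimes>\<^sub>0 x) \<otimes>\<^sub>1 \<alpha>) \<circ>\<^sub>1 (\<eta>' \<otimes>\<^sub>1 id\<^sub>1 y) \<cong> (\<eta>' \<otimes>\<^sub>1 id\<^sub>1 y') \<circ>\<^sub>1 \<alpha>"
    using iso1_sym[OF iso1_slide[OF \<eta>' \<alpha>]] tensor1_unit_left hom1D[OF \<alpha>] by simp
  have "comparison y y' \<epsilon> \<eta>'
      \<cong> ((id\<^sub>1 y' \<otimes>\<^sub>1 \<epsilon>') \<circ>\<^sub>1 (id\<^sub>1 (y' \<otimes>\<^sub>0 x) \<otimes>\<^sub>1 \<alpha>)) \<circ>\<^sub>1 (\<eta>' \<otimes>\<^sub>1 id\<^sub>1 y)"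
    unfolding comparison_def by (rule iso1_comp_right[OF * h(1,3)])
  also have "\<dots> \<cong> (id\<^sub>1 y' \<otimes>\<^sub>1 \<epsilon>') \<circ>\<^sub>1 ((id\<^sub>1 (y' \<otimes>\<^sub>0 x) \<otimes>\<^sub>1 \<alpha>) \<circ>\<^sub>1 (\<eta>' \<otimes>\<^sub>1 id\<^sub>1 y))"
    by (rule iso1_assoc[OF h(2) y'x\<alpha> h(3)])
  also have "\<dots> \<cong> (id\<^sub>1 y' \<otimes>\<^sub>1 \<epsilon>') \<circ>\<^sub>1 ((\<eta>' \<otimes>\<^sub>1 id\<^sub>1 y') \<circ>\<^sub>1 \<alpha>)"
    by (rule iso1_comp_left[OF slide h(2) comp1_hom[OF y'x\<alpha> h(3)]])
  also have "\<dots> \<cong> ((id\<^sub>1 y' \<otimes>\<^sub>1 \<epsilon>') \<circ>\<^sub>1 (\<eta>' \<otimes>\<^sub>1 id\<^sub>1 y')) \<circ>\<^sub>1 \<alpha>"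
    by (rule iso1_sym[OF iso1_assoc[OF h(2,4) \<alpha>]])
  also have "\<dots> \<cong> id\<^sub>1 y' \<circ>\<^sub>1 \<alpha>"
    by (rule iso1_comp_right[OF zigzag comp1_hom[OF h(2,4)] \<alpha>])
  also have "\<dots> \<cong> \<alpha>"
    by (rule iso1_lunit[OF \<alpha>])
  finally show ?thesis .
qed

text \<open>The two evaluations act on disjoint factors of
  \<open>x \<otimes> y' \<otimes> x \<otimes> y\<close>, so they can be exchanged. Then
  \<open>\<epsilon>'\<close> meets \<open>\<eta>'\<close>, and the zigzag of the second pairing at
  \<open>x\<close>, whiskered with \<open>y\<close>, removes both and leaves
  \<open>\<epsilon>\<close>.\<close>

lemma comparison_ev:
  assumes p: "biexact_pairing C x y \<epsilon> \<eta>" and p': "biexact_pairing C x y' \<epsilon>' \<eta>'"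
  shows "\<epsilon>' \<circ>\<^sub>1 (id\<^sub>1 x \<otimes>\<^sub>1 comparison y y' \<epsilon> \<eta>') \<cong> \<epsilon>"
proof -
  have o: "x \<in> Obj C" "y \<in> Obj C" "y' \<in> Obj C" "x \<otimes>\<^sub>0 y \<in> Obj C" "x \<otimes>\<^sub>0 y' \<in> Obj C"
    using p p' tensor0_Obj unfolding biexact_pairing_def by auto
  have \<epsilon>: "\<epsilon> \<in> hom1 C (x \<otimes>\<^sub>0 y) \<one>" and \<epsilon>': "\<epsilon>' \<in> hom1 C (x \<otimes>\<^sub>0 y') \<one>"
    and \<eta>': "\<eta>' \<in> hom1 C \<one> (y' \<otimes>\<^sub>0 x)"
    and zigzag: "id\<^sub>1 x \<cong> (\<epsilon>' \<otimes>\<^sub>1 id\<^sub>1 x) \<circ>\<^sub>1 (id\<^sub>1 x \<otimes>\<^sub>1 \<eta>')"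
    using p p' unfolding biexact_pairing_def by auto
  note h = ev_whisker_hom(1)[OF \<epsilon> o(1,2,3)] coev_whisker_hom(2)[OF \<eta>' o(1,3,2)]
    ev_whisker_hom(2)[OF \<epsilon>' o(1,3,1)] coev_whisker_hom(1)[OF \<eta>' o(1,3,1)]
  \<comment> \<open>Bracketed to the left to fit the zigzag at \<open>x\<close> tensored with
    \<open>id\<^sub>1 y\<close>; \<open>whisker_assoc\<close> equates it with the form that comes
    from whiskering the comparison.\<close>
  let ?c = "(id\<^sub>1 x \<otimes>\<^sub>1 \<eta>') \<otimes>\<^sub>1 id\<^sub>1 y"
  have c: "?c \<in> hom1 C (x \<otimes>\<^sub>0 y) (x \<otimes>\<^sub>0 y' \<otimes>\<^sub>0 x \<otimes>\<^sub>0 y)"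
    using whisker_right_hom[OF h(4) o(2)] o by (simp add: tensor0_assoc tensor0_Obj)
  have e: "id\<^sub>1 (x \<otimes>\<^sub>0 y') \<otimes>\<^sub>1 \<epsilon> \<in> hom1 C (x \<otimes>\<^sub>0 y' \<otimes>\<^sub>0 x \<otimes>\<^sub>0 y) (x \<otimes>\<^sub>0 y')"
    using ev_whisker_hom(1)[OF \<epsilon> o(1,2,5)] o by (simp add: tensor0_assoc)
  have e': "\<epsilon>' \<otimes>\<^sub>1 id\<^sub>1 (x \<otimes>\<^sub>0 y) \<in> hom1 C (x \<otimes>\<^sub>0 y' \<otimes>\<^sub>0 x \<otimes>\<^sub>0 y) (x \<otimes>\<^sub>0 y)"
    using ev_whisker_hom(2)[OF \<epsilon>' o(1,3,4)] .
  have ex: "(\<epsilon>' \<otimes>\<^sub>1 id\<^sub>1 x) \<otimes>\<^sub>1 id\<^sub>1 y \<cong> \<epsilon>' \<otimes>\<^sub>1 id\<^sub>1 (x \<otimes>\<^sub>0 y)"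
    by (rule iso1_whisker_right_right[OF \<epsilon>' o(1,2)])
  \<comment> \<open>Both evaluations end at \<open>\<one>\<close>, so the outer factors in
    \<open>iso1_slide\<close> are whiskerings by \<open>id\<^sub>1 \<one>\<close> and
    disappear.\<close>
  have slide: "\<epsilon>' \<circ>\<^sub>1 (id\<^sub>1 (x \<otimes>\<^sub>0 y') \<otimes>\<^sub>1 \<epsilon>) \<cong> \<epsilon> \<circ>\<^sub>1 (\<epsilon>' \<otimes>\<^sub>1 id\<^sub>1 (x \<otimes>\<^sub>0 y))"
    using iso1_slide[OF \<epsilon>' \<epsilon>] hom1D[OF \<epsilon>] hom1D[OF \<epsilon>'] by (simp add: tensor1_unit_left tensor1_unit_right)
  have "(\<epsilon>' \<otimes>\<^sub>1 id\<^sub>1 (x \<otimes>\<^sub>0 y)) \<circ>\<^sub>1 ?c \<cong> ((\<epsilon>' \<otimes>\<^sub>1 id\<^sub>1 x) \<otimes>\<^sub>1 id\<^sub>1 y) \<circ>\<^sub>1 ?c"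
    by (rule iso1_comp_right[OF iso1_sym[OF ex] e' c])
  also have "\<dots> \<cong> ((\<epsilon>' \<otimes>\<^sub>1 id\<^sub>1 x) \<circ>\<^sub>1 (id\<^sub>1 x \<otimes>\<^sub>1 \<eta>')) \<otimes>\<^sub>1 id\<^sub>1 y"
    by (rule iso1_sym[OF iso1_whisker_right_comp[OF h(3,4) o(2)]])
  also have "\<dots> \<cong> id\<^sub>1 x \<otimes>\<^sub>1 id\<^sub>1 y"
    by (rule iso1_tensor_right[OF iso1_sym[OF zigzag] o(2)])
  also have "\<dots> \<cong> id\<^sub>1 (x \<otimes>\<^sub>0 y)"
    by (rule iso1_tensor_id[OF o(1,2)])
  finally have collapse: "(\<epsilon>' \<otimes>\<^sub>1 id\<^sub>1 (x \<otimes>\<^sub>0 y)) \<circ>\<^sub>1 ?c \<cong> id\<^sub>1 (x \<otimes>\<^sub>0 y)" .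
  have "id\<^sub>1 x \<otimes>\<^sub>1 comparison y y' \<epsilon> \<eta>' \<cong> (id\<^sub>1 x \<otimes>\<^sub>1 (id\<^sub>1 y' \<otimes>\<^sub>1 \<epsilon>)) \<circ>\<^sub>1 ?c"
    unfolding comparison_def whisker_assoc[OF \<eta>' o(1,2)] by (rule iso1_whisker_left_comp[OF h(1,2) o(1)])
  also have "\<dots> \<cong> (id\<^sub>1 (x \<otimes>\<^sub>0 y') \<otimes>\<^sub>1 \<epsilon>) \<circ>\<^sub>1 ?c"
    by (rule iso1_comp_right[OF iso1_whisker_left_left[OF \<epsilon> o(1,3)] whisker_left_hom[OF h(1) o(1)] c])
  finally have "\<epsilon>' \<circ>\<^sub>1 (id\<^sub>1 x \<otimes>\<^sub>1 comparison y y' \<epsilon> \<eta>') \<cong> \<epsilon>' \<circ>\<^sub>1 ((id\<^sub>1 (x \<otimes>\<^sub>0 y') \<otimes>\<^sub>1 \<epsilon>) \<circ>\<^sub>1 ?c)"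
    by (rule iso1_comp_left[OF _ \<epsilon>' whisker_left_hom[OF comparison_hom[OF p p'] o(1)]])
  also have "\<dots> \<cong> (\<epsilon>' \<circ>\<^sub>1 (id\<^sub>1 (x \<otimes>\<^sub>0 y') \<otimes>\<^sub>1 \<epsilon>)) \<circ>\<^sub>1 ?c"
    by (rule iso1_sym[OF iso1_assoc[OF \<epsilon>' e c]])
  also have "\<dots> \<cong> (\<epsilon> \<circ>\<^sub>1 (\<epsilon>' \<otimes>\<^sub>1 id\<^sub>1 (x \<otimes>\<^sub>0 y))) \<circ>\<^sub>1 ?c"
    by (rule iso1_comp_right[OF slide comp1_hom[OF \<epsilon>' e] c])
  also have "\<dots> \<cong> \<epsilon> \<circ>\<^sub>1 ((\<epsilon>' \<otimes>\<^sub>1 id\<^sub>1 (x \<otimes>\<^sub>0 y)) \<circ>\<^sub>1 ?c)"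
    by (rule iso1_assoc[OF \<epsilon> e' c])
  also have "\<dots> \<cong> \<epsilon> \<circ>\<^sub>1 id\<^sub>1 (x \<otimes>\<^sub>0 y)"
    by (rule iso1_comp_left[OF collapse \<epsilon> comp1_hom[OF e' c]])
  also have "\<dots> \<cong> \<epsilon>"
    by (rule iso1_runit[OF \<epsilon>])
  finally show ?thesis .
qed

text \<open>Dual to the argument for evaluation: here the two coevaluations are exchanged,
  \<open>\<epsilon>\<close> meets \<open>\<eta>\<close>, and the zigzag of the first pairing at
  \<open>x\<close>, whiskered with \<open>y'\<close>, leaves \<open>\<eta>'\<close>.\<close>

lemma comparison_coev:
  assumes p: "biexact_pairing C x y \<epsilon> \<eta>" and p': "biexact_pairing C x y' \<epsilon>' \<eta>'"
  shows "(comparison y y' \<epsilon> \<eta>' \<otimes>\<^sub>1 id\<^sub>1 x) \<circ>\<^sub>1 \<eta> \<cong> \<eta>'"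
proof -
  have o: "x \<in> Obj C" "y \<in> Obj C" "y' \<in> Obj C" "y \<otimes>\<^sub>0 x \<in> Obj C" "y' \<otimes>\<^sub>0 x \<in> Obj C"
    using p p' tensor0_Obj unfolding biexact_pairing_def by auto
  have \<epsilon>: "\<epsilon> \<in> hom1 C (x \<otimes>\<^sub>0 y) \<one>" and \<eta>: "\<eta> \<in> hom1 C \<one> (y \<otimes>\<^sub>0 x)"
    and \<eta>': "\<eta>' \<in> hom1 C \<one> (y' \<otimes>\<^sub>0 x)"
    and zigzag: "id\<^sub>1 x \<cong> (\<epsilon> \<otimes>\<^sub>1 id\<^sub>1 x) \<circ>\<^sub>1 (id\<^sub>1 x \<otimes>\<^sub>1 \<eta>)"
    using p p' unfolding biexact_pairing_def by auto
  note h = ev_whisker_hom(1)[OF \<epsilon> o(1,2,3)] coev_whisker_hom(2)[OF \<eta>' o(1,3,2)]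
    ev_whisker_hom(2)[OF \<epsilon> o(1,2,1)] coev_whisker_hom(1)[OF \<eta> o(1,2,1)]
  \<comment> \<open>Bracketed to the right to fit the zigzag at \<open>x\<close>; it equals
    \<open>(id\<^sub>1 y' \<otimes>\<^sub>1 \<epsilon>) \<otimes>\<^sub>1 id\<^sub>1 x\<close>, the
    form that comes from the comparison.\<close>
  let ?e = "id\<^sub>1 y' \<otimes>\<^sub>1 (\<epsilon> \<otimes>\<^sub>1 id\<^sub>1 x)"
  have e: "?e \<in> hom1 C (y' \<otimes>\<^sub>0 x \<otimes>\<^sub>0 y \<otimes>\<^sub>0 x) (y' \<otimes>\<^sub>0 x)"
    using whisker_left_hom[OF h(3) o(3)] .
  have c: "id\<^sub>1 (y' \<otimes>\<^sub>0 x) \<otimes>\<^sub>1 \<eta> \<in> hom1 C (y' \<otimes>\<^sub>0 x) (y' \<otimes>\<^sub>0 x \<otimes>\<^sub>0 y \<otimes>\<^sub>0 x)"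
    using coev_whisker_hom(1)[OF \<eta> o(1,2,5)] o by (simp add: tensor0_assoc)
  have c': "\<eta>' \<otimes>\<^sub>1 id\<^sub>1 (y \<otimes>\<^sub>0 x) \<in> hom1 C (y \<otimes>\<^sub>0 x) (y' \<otimes>\<^sub>0 x \<otimes>\<^sub>0 y \<otimes>\<^sub>0 x)"
    using coev_whisker_hom(2)[OF \<eta>' o(1,3,4)] .
  have cx: "(\<eta>' \<otimes>\<^sub>1 id\<^sub>1 y) \<otimes>\<^sub>1 id\<^sub>1 x \<cong> \<eta>' \<otimes>\<^sub>1 id\<^sub>1 (y \<otimes>\<^sub>0 x)"
    by (rule iso1_whisker_right_right[OF \<eta>' o(2,1)])
  \<comment> \<open>Both coevaluations start at \<open>\<one>\<close>, so the inner factors in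
    \<open>iso1_slide\<close> are whiskerings by \<open>id\<^sub>1 \<one>\<close>.\<close>
  have slide: "(\<eta>' \<otimes>\<^sub>1 id\<^sub>1 (y \<otimes>\<^sub>0 x)) \<circ>\<^sub>1 \<eta> \<cong> (id\<^sub>1 (y' \<otimes>\<^sub>0 x) \<otimes>\<^sub>1 \<eta>) \<circ>\<^sub>1 \<eta>'"
    using iso1_slide[OF \<eta>' \<eta>] hom1D[OF \<eta>] hom1D[OF \<eta>'] by (simp add: tensor1_unit_left tensor1_unit_right)
  have "?e \<circ>\<^sub>1 (id\<^sub>1 (y' \<otimes>\<^sub>0 x) \<otimes>\<^sub>1 \<eta>) \<cong> ?e \<circ>\<^sub>1 (id\<^sub>1 y' \<otimes>\<^sub>1 (id\<^sub>1 x \<otimes>\<^sub>1 \<eta>))"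
    by (rule iso1_comp_left[OF iso1_sym[OF iso1_whisker_left_left[OF \<eta> o(3,1)]] e c])
  also have "\<dots> \<cong> id\<^sub>1 y' \<otimes>\<^sub>1 ((\<epsilon> \<otimes>\<^sub>1 id\<^sub>1 x) \<circ>\<^sub>1 (id\<^sub>1 x \<otimes>\<^sub>1 \<eta>))"
    by (rule iso1_sym[OF iso1_whisker_left_comp[OF h(3,4) o(3)]])
  also have "\<dots> \<cong> id\<^sub>1 y' \<otimes>\<^sub>1 id\<^sub>1 x"
    by (rule iso1_tensor_left[OF iso1_sym[OF zigzag] o(3)])
  also have "\<dots> \<cong> id\<^sub>1 (y' \<otimes>\<^sub>0 x)"
    by (rule iso1_tensor_id[OF o(3,1)])
  finally have collapse: "?e \<circ>\<^sub>1 (id\<^sub>1 (y' \<otimes>\<^sub>0 x) \<otimes>\<^sub>1 \<eta>) \<cong> id\<^sub>1 (y' \<otimes>\<^sub>0 x)" .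
  have "comparison y y' \<epsilon> \<eta>' \<otimes>\<^sub>1 id\<^sub>1 x \<cong> ?e \<circ>\<^sub>1 ((\<eta>' \<otimes>\<^sub>1 id\<^sub>1 y) \<otimes>\<^sub>1 id\<^sub>1 x)"
    unfolding comparison_def whisker_assoc[OF \<epsilon> o(3,1), symmetric]
    by (rule iso1_whisker_right_comp[OF h(1,2) o(1)])
  also have "\<dots> \<cong> ?e \<circ>\<^sub>1 (\<eta>' \<otimes>\<^sub>1 id\<^sub>1 (y \<otimes>\<^sub>0 x))"
    \<comment> \<open>The typing of the left side of \<open>cx\<close> is transported from its right
      side, which \<open>c'\<close> types.\<close>
    by (rule iso1_comp_left[OF cx e]) (use iso1_hom1[OF cx] c' in blast)
  finally have "(comparison y y' \<epsilon> \<eta>' \<otimes>\<^sub>1 id\<^sub>1 x) \<circ>\<^sub>1 \<eta> \<cong> (?e \<circ>\<^sub>1 (\<eta>' \<otimes>\<^sub>1 id\<^sub>1 (y \<otimes>\<^sub>0 x))) \<circ>\<^sub>1 \<eta>"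
    by (rule iso1_comp_right[OF _ whisker_right_hom[OF comparison_hom[OF p p'] o(1)] \<eta>])
  also have "\<dots> \<cong> ?e \<circ>\<^sub>1 ((\<eta>' \<otimes>\<^sub>1 id\<^sub>1 (y \<otimes>\<^sub>0 x)) \<circ>\<^sub>1 \<eta>)"
    by (rule iso1_assoc[OF e c' \<eta>])
  also have "\<dots> \<cong> ?e \<circ>\<^sub>1 ((id\<^sub>1 (y' \<otimes>\<^sub>0 x) \<otimes>\<^sub>1 \<eta>) \<circ>\<^sub>1 \<eta>')"
    by (rule iso1_comp_left[OF slide e comp1_hom[OF c' \<eta>]])
  also have "\<dots> \<cong> (?e \<circ>\<^sub>1 (id\<^sub>1 (y' \<otimes>\<^sub>0 x) \<otimes>\<^sub>1 \<eta>)) \<circ>\<^sub>1 \<eta>'"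
    by (rule iso1_sym[OF iso1_assoc[OF e c \<eta>']])
  also have "\<dots> \<cong> id\<^sub>1 (y' \<otimes>\<^sub>0 x) \<circ>\<^sub>1 \<eta>'"
    by (rule iso1_comp_right[OF collapse comp1_hom[OF e c] \<eta>'])
  also have "\<dots> \<cong> \<eta>'"
    by (rule iso1_lunit[OF \<eta>'])
  finally show ?thesis .
qed

text \<open>Preservation of evaluation composes: \<open>?\<beta>\<close> turns \<epsilon> into
  \<open>\<epsilon>'\<close>, and \<open>?\<alpha>\<close> turns it back. Exchanging the two
  pairings in this lemma yields the other composite.\<close>

lemma comparison_inverse:
  assumes p: "biexact_pairing C x y \<epsilon> \<eta>" and p': "biexact_pairing C x y' \<epsilon>' \<eta>'"
  shows "comparison y' y \<epsilon>' \<eta> \<circ>\<^sub>1 comparison y y' \<epsilon> \<eta>' \<cong> id\<^sub>1 y"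
proof -
  let ?\<alpha> = "comparison y y' \<epsilon> \<eta>'" and ?\<beta> = "comparison y' y \<epsilon>' \<eta>"
  have x: "x \<in> Obj C" and \<epsilon>: "\<epsilon> \<in> hom1 C (x \<otimes>\<^sub>0 y) \<one>"
    using p unfolding biexact_pairing_def by auto
  have \<alpha>: "?\<alpha> \<in> hom1 C y y'" and \<beta>: "?\<beta> \<in> hom1 C y' y"
    using comparison_hom p p' by blast+
  note x\<alpha> = whisker_left_hom[OF \<alpha> x] and x\<beta> = whisker_left_hom[OF \<beta> x]
  have "\<epsilon> \<circ>\<^sub>1 (id\<^sub>1 x \<otimes>\<^sub>1 (?\<beta> \<circ>\<^sub>1 ?\<alpha>)) \<cong> \<epsilon> \<circ>\<^sub>1 ((id\<^sub>1 x \<otimes>\<^sub>1 ?\<beta>) \<circ>\<^sub>1 (id\<^sub>1 x \<otimes>\<^sub>1 ?\<alpha>))"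
    by (rule iso1_comp_left[OF iso1_whisker_left_comp[OF \<beta> \<alpha> x] \<epsilon> whisker_left_hom[OF comp1_hom[OF \<beta> \<alpha>] x]])
  also have "\<dots> \<cong> (\<epsilon> \<circ>\<^sub>1 (id\<^sub>1 x \<otimes>\<^sub>1 ?\<beta>)) \<circ>\<^sub>1 (id\<^sub>1 x \<otimes>\<^sub>1 ?\<alpha>)"
    by (rule iso1_sym[OF iso1_assoc[OF \<epsilon> x\<beta> x\<alpha>]])
  also have "\<dots> \<cong> \<epsilon>' \<circ>\<^sub>1 (id\<^sub>1 x \<otimes>\<^sub>1 ?\<alpha>)"
    by (rule iso1_comp_right[OF comparison_ev[OF p' p] comp1_hom[OF \<epsilon> x\<beta>] x\<alpha>])
  also have "\<dots> \<cong> \<epsilon>"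
    by (rule comparison_ev[OF p p'])
  \<comment> \<open>The chain is the evaluation premise of \<open>comparison_unique\<close>, with
    the pairing of \<open>x\<close> and \<open>y\<close> as both source and target.\<close>
  finally have "comparison y y \<epsilon> \<eta> \<cong> ?\<beta> \<circ>\<^sub>1 ?\<alpha>"
    by (rule comparison_unique[OF p p comp1_hom[OF \<beta> \<alpha>]])
  then show ?thesis
    by (rule iso1_trans[OF iso1_sym comparison_self[OF p]])
qed

end

theorem lemma3p3p1:
  fixes C :: "('o, 'm, 't, 'z) monoidal_bicat_scheme" (structure)
    and A B B' :: 'o and \<epsilon> \<eta> \<epsilon>' \<eta>' :: 'm
  assumes "strict_monoidal_bicategory C"
    and "A \<in> Obj C" and "B \<in> Obj C" and "B' \<in> Obj C"
    and "biexact_pairing C A B \<epsilon> \<eta>"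
    and "biexact_pairing C A B' \<epsilon>' \<eta>'"
  shows "\<exists>\<alpha> \<beta>. \<alpha> \<in> hom1 C B B' \<and> \<beta> \<in> hom1 C B' B \<and>
    \<beta> \<circ>\<^sub>1 \<alpha> \<cong> id\<^sub>1 B \<and> \<alpha> \<circ>\<^sub>1 \<beta> \<cong> id\<^sub>1 B' \<and>
    preserves_pairing C A \<epsilon> \<eta> \<epsilon>' \<eta>' \<alpha> \<and>
    (\<forall>\<alpha>'. \<alpha>' \<in> hom1 C B B' \<and> preserves_pairing C A \<epsilon> \<eta> \<epsilon>' \<eta>' \<alpha>' \<longrightarrow> \<alpha> \<cong> \<alpha>')"
proof -
  interpret strict_monoidal_bicategory C by fact
  note p = assms(5) and p' = assms(6)
  \<comment> \<open>The witnesses are \<open>comparison B B' \<epsilon> \<eta>'\<close> for \<alpha>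
    and \<open>comparison B' B \<epsilon>' \<eta>\<close> for \<beta>.\<close>
  show ?thesis
    using comparison_hom[OF p p'] comparison_hom[OF p' p]
      comparison_inverse[OF p p'] comparison_inverse[OF p' p]
      comparison_ev[OF p p'] comparison_coev[OF p p'] comparison_unique[OF p p']
    unfolding preserves_pairing_def by blast
qed

end
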